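(* The singular moduli $\alpha_{36}$ and $\alpha_{4/9}$ satisfy $$\alpha_{36}=\left(\sqrt{2}-1\right)^4\left(\sqrt{3}-\sqrt{2}\right)^4\left(\sqrt{\frac{\sqrt{3}+3}{2}}-\sqrt{\frac{\sqrt{3}+1}{2}}\right)^8,$$ $$\alpha_{4/9}=\left(\sqrt{2}-1\right)^4\left(\sqrt{3}-\sqrt{2}\right)^4\left(\sqrt{\frac{\sqrt{3}+3}{2}}+\sqrt{\frac{\sqrt{3}+1}{2}}\right)^8.$$
   Context: For a positive real $r$, the singular modulus $\alpha_r\in(0,1)$ is the unique number with $\dfrac{{}_2F_1(1/2,1/2;1;1-\alpha_r)}{{}_2F_1(1/2,1/2;1;\alpha_r)}=\sqrt{r}$, where ${}_2F_1$ is the Gaussian hypergeometric function. *)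

theory Defs
  imports "HOL-Analysis.Analysis"
begin

text \<open>
  The last argument \<open>1\<close> of \<^const>\<open>fps_hypergeo\<close> is a scaling factor for the variable.
  The series represents the Gaussian hypergeometric function on the real interval \<open>-1 < z < 1\<close>,
  which is the only place where it is evaluated below.
\<close>

definition hyp2F1 :: "real \<Rightarrow> real \<Rightarrow> real \<Rightarrow> real \<Rightarrow> real" where
  "hyp2F1 a b c z = eval_fps (fps_hypergeo [a, b] [c] 1) z"

lemma hyp2F1_altdef:
  "hyp2F1 a b c z =
     (\<Sum>n. pochhammer a n * pochhammer b n / (pochhammer c n * fact n) * z ^ n)"
  by (simp add: hyp2F1_def eval_fps_def)

text \<open>Meaningful for \<open>r > 0\<close> only.\<close>

definition singular_modulus :: "real \<Rightarrow> real" where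
  "singular_modulus r =
     (THE \<alpha>. 0 < \<alpha> \<and> \<alpha> < 1 \<and>
        hyp2F1 (1/2) (1/2) 1 (1 - \<alpha>) / hyp2F1 (1/2) (1/2) 1 \<alpha> = sqrt r)"

end

theory Submission
  imports Defs
begin

text \<open>
  Write \<open>F(z)\<close> for the hypergeometric function and \<open>R(z) = F(1 - z) / F(z)\<close>. The transformations
  \<open>F(4x / (1 + x)\<^sup>2) = (1 + x) F(x\<^sup>2)\<close> (Landen) and
  \<open>F(p (2 + p)\<^sup>3 / (1 + 2p)\<^sup>3) = (1 + 2p) F(p\<^sup>3 (2 + p) / (1 + 2p))\<close> (Ramanujan, degree 3) hold because
  both sides solve the same second-order linear differential equation and are regular at its
  singular point \<open>0\<close>. Each is self-dual under an involution of the parameter, so the first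
  multiplies \<open>R\<close> by 2 and the second by 3. Since \<open>R(1/2) = 1\<close>, Landen gives
  \<open>R((\<surd>2 - 1)\<^sup>4) = 2\<close>; one cubic step forwards and one backwards from \<open>(\<surd>2 - 1)\<^sup>4\<close>
  reach the points with \<open>R = 6\<close> and \<open>R = 2/3\<close>.
\<close>

section \<open>The hypergeometric function and its differential equation\<close>

abbreviation hypF_fps :: "real fps" where
  "hypF_fps \<equiv> fps_hypergeo [1/2, 1/2] [1] 1"

definition hypF :: "real \<Rightarrow> real" where
  "hypF = hyp2F1 (1/2) (1/2) 1"

definition hypF' :: "real \<Rightarrow> real" where
  "hypF' = eval_fps (fps_deriv hypF_fps)"

lemma hypF_eq_eval_fps: "hypF = eval_fps hypF_fps"
  by (auto simp: hypF_def hyp2F1_def)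

lemma hypF_fps_Suc: "fps_nth hypF_fps (Suc n) = ((1/2 + real n) / (1 + real n))\<^sup>2 * fps_nth hypF_fps n"
  unfolding fps_hypergeo_rec by (simp add: power2_eq_square add_ac)

text \<open>Consecutive coefficients differ by the square of a factor in \<open>(0, 1)\<close>.
  Positivity later makes \<open>hypF\<close> and \<open>hypF'\<close> positive; the bound by 1
  allows comparison with the geometric series.\<close>

lemma hypF_fps_bounds: "0 < fps_nth hypF_fps n \<and> fps_nth hypF_fps n \<le> 1"
proof (induction n)
  case 0
  show ?case by (simp del: fps_hypergeo_nth)
next
  case (Suc n)
  have "((1/2 + real n) / (1 + real n))\<^sup>2 \<le> 1\<^sup>2"
    by (intro power_mono) (auto simp: field_simps)
  moreover have "0 < ((1/2 + real n) / (1 + real n))\<^sup>2"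
    by (intro zero_less_power divide_pos_pos) auto
  ultimately show ?case
    using Suc unfolding hypF_fps_Suc
    by (auto intro!: mult_le_one mult_pos_pos simp del: fps_hypergeo_nth)
qed

lemma fps_conv_radius_hypF: "fps_conv_radius hypF_fps \<ge> 1"
  unfolding fps_conv_radius_def
proof (rule conv_radius_geI_ex)
  fix r :: real
  assume r: "0 < r" "ereal r < 1"
  have "summable (\<lambda>n. fps_nth hypF_fps n * r ^ n)"
  proof (rule summable_comparison_test')
    show "summable (\<lambda>n. r ^ n)"
      using r by (intro summable_geometric) (auto simp: one_ereal_def)
    show "norm (fps_nth hypF_fps n * r ^ n) \<le> r ^ n" for n
      using hypF_fps_bounds[of n] r
      by (auto simp: abs_mult intro!: mult_left_le_one_le simp del: fps_hypergeo_nth)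
  qed
  then show "\<exists>z. norm z = r \<and> summable (\<lambda>n. fps_nth hypF_fps n * z ^ n)"
    using r by (intro exI[of _ r]) auto
qed

lemma fps_conv_radius_hypF': "fps_conv_radius (fps_deriv hypF_fps) \<ge> 1"
  using fps_conv_radius_deriv[of hypF_fps] fps_conv_radius_hypF by (rule order_trans[rotated])

lemma norm_less_fps_conv_radius:
  fixes z :: real
  assumes "\<bar>z\<bar> < 1" "fps_conv_radius f \<ge> 1"
  shows "ereal (norm z) < fps_conv_radius f"
  using assms by (auto intro!: less_le_trans[of _ 1 "fps_conv_radius f"])

lemma eval_fps_pos:
  fixes f :: "real fps"
  assumes "\<And>n. fps_nth f n \<ge> 0" "fps_nth f 0 > 0" "0 \<le> z" "ereal z < fps_conv_radius f"
  shows "eval_fps f z > 0"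
proof -
  have "summable (\<lambda>n. fps_nth f n * z ^ n)"
    by (rule summable_fps) (use assms in auto)
  then show ?thesis
    unfolding eval_fps_def using assms by (intro suminf_pos2[of _ 0]) auto
qed

lemma hypF_0: "hypF 0 = 1"
  by (simp add: hypF_eq_eval_fps eval_fps_at_0 del: fps_hypergeo_nth)

lemma hypF_pos: "hypF z > 0" if "0 \<le> z" "z < 1"
  unfolding hypF_eq_eval_fps
  using that hypF_fps_bounds norm_less_fps_conv_radius[OF _ fps_conv_radius_hypF, of z]
  by (intro eval_fps_pos) (auto simp: less_imp_le simp del: fps_hypergeo_nth)

lemma hypF'_pos: "hypF' z > 0" if "0 \<le> z" "z < 1"
  unfolding hypF'_def
  using that hypF_fps_bounds norm_less_fps_conv_radius[OF _ fps_conv_radius_hypF', of z]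
  by (intro eval_fps_pos) (auto simp: less_imp_le simp del: fps_hypergeo_nth)

lemma has_field_derivative_hypF:
  assumes "\<bar>z\<bar> < 1"
  shows "(hypF has_field_derivative hypF' z) (at z within A)"
  unfolding hypF_eq_eval_fps hypF'_def
  by (intro has_field_derivative_eval_fps norm_less_fps_conv_radius assms fps_conv_radius_hypF)

text \<open>In terms of the complete elliptic integrals K and E with parameter \<open>z\<close>,
  this is (E - (1 - z) K) / pi for \<open>0 < z < 1\<close>. Pairing it with \<open>hypF\<close>
  turns the second-order equation into a first-order system.\<close>

definition hypE :: "real \<Rightarrow> real" where
  "hypE z = z * (1 - z) * hypF' z"

lemma hypE_0: "hypE 0 = 0"
  by (simp add: hypE_def)

text \<open>The hypergeometric equation in self-adjoint form, \<open>(z (1 - z) F')' = F / 4\<close>.\<close>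

lemma hypF_fps_ode:
  "fps_deriv ((fps_X - fps_X ^ 2) * fps_deriv hypF_fps) = fps_const (1/4) * hypF_fps"
proof (rule fps_ext)
  fix n
  have nth: "fps_nth (fps_deriv hypF_fps) k = (real k + 1) * fps_nth hypF_fps (Suc k)" for k
    by (simp del: fps_hypergeo_nth add: add_ac)
  have "fps_nth ((fps_X - fps_X ^ 2) * fps_deriv hypF_fps) (Suc n) =
        (real n + 1) * fps_nth hypF_fps (Suc n) - real n * fps_nth hypF_fps n"
  \<comment> \<open>Multiplication by \<open>fps_X ^ 2\<close> shifts past the constant term, so
    \<open>n = 0\<close> is separate; the factor \<open>real n\<close> makes the common formula
    right there too.\<close>
  proof (cases n)
    case 0
    then show ?thesis
      by (simp add: left_diff_distrib power2_eq_square mult.assoc nth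
               del: fps_hypergeo_nth fps_deriv_nth)
  next
    case (Suc m)
    then show ?thesis
      by (simp add: left_diff_distrib power2_eq_square mult.assoc nth
               del: fps_hypergeo_nth fps_deriv_nth)
  qed
  then have "fps_nth (fps_deriv ((fps_X - fps_X ^ 2) * fps_deriv hypF_fps)) n =
      (real n + 1) * ((real n + 1) * fps_nth hypF_fps (Suc n) - real n * fps_nth hypF_fps n)"
    unfolding fps_deriv_nth[of "_ * _"] by (simp add: add_ac)
  also have "\<dots> = 1/4 * fps_nth hypF_fps n"
    unfolding hypF_fps_Suc
    by (simp add: divide_simps del: fps_hypergeo_nth)
      (simp add: algebra_simps power2_eq_square del: fps_hypergeo_nth)
  finally show "fps_nth (fps_deriv ((fps_X - fps_X ^ 2) * fps_deriv hypF_fps)) n =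
      fps_nth (fps_const (1/4) * hypF_fps) n"
    by (simp del: fps_hypergeo_nth)
qed

lemma has_field_derivative_hypE:
  assumes "\<bar>z\<bar> < 1"
  shows "(hypE has_field_derivative hypF z / 4) (at z within A)"
proof -
  let ?Q = "(fps_X - fps_X ^ 2) * fps_deriv hypF_fps"
  have rad: "fps_conv_radius (fps_X - fps_X ^ 2 :: real fps) \<ge> 1"
    by (rule order_trans[OF _ fps_conv_radius_diff]) auto
  have "min (fps_conv_radius (fps_X - fps_X ^ 2 :: real fps)) (fps_conv_radius (fps_deriv hypF_fps))
          \<le> fps_conv_radius ?Q"
    by (rule fps_conv_radius_mult)
  then have radQ: "fps_conv_radius ?Q \<ge> 1"
    using rad fps_conv_radius_hypF' by (meson min.boundedI order_trans)
  have eq: "hypE w = eval_fps ?Q w" if "\<bar>w\<bar> < 1" for w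
    using norm_less_fps_conv_radius[OF that rad] norm_less_fps_conv_radius[OF that fps_conv_radius_hypF']
    by (simp add: eval_fps_mult eval_fps_diff hypE_def hypF'_def del: fps_hypergeo_nth)
       (simp add: algebra_simps power2_eq_square)
  have "(eval_fps ?Q has_field_derivative eval_fps (fps_deriv ?Q) z) (at z)"
    by (intro has_field_derivative_eval_fps norm_less_fps_conv_radius assms radQ)
  also have "eval_fps (fps_deriv ?Q) z = hypF z / 4"
    unfolding hypF_fps_ode
    using norm_less_fps_conv_radius[OF assms fps_conv_radius_hypF]
    by (simp add: eval_fps_mult hypF_eq_eval_fps)
  finally have "(hypE has_field_derivative hypF z / 4) (at z)"
    by (rule has_field_derivative_transform_within_open[where S = "{-1<..<1}"])
       (use assms eq in \<open>auto simp: abs_less_iff\<close>)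
  then show ?thesis
    by (rule has_field_derivative_at_within)
qed

lemma hypF_strict_mono: "hypF x < hypF y" if "0 \<le> x" "x < y" "y < 1"
proof (rule DERIV_pos_imp_increasing[OF that(2)])
  fix z assume "x \<le> z" "z \<le> y"
  then show "\<exists>d. DERIV hypF z :> d \<and> d > 0"
    using that has_field_derivative_hypF[of z] hypF'_pos[of z] by auto
qed

section \<open>Modular transformations\<close>

text \<open>
  The function \<open>q\<close> stands for \<open>N m' / m\<^sup>2\<close>. With \<open>u = F \<circ> a\<close> and \<open>v = m (F \<circ> b)\<close>, the assumptions
  say that both \<open>u\<close> and \<open>v\<close> solve \<open>((N / m\<^sup>2) y')' = (c\<^sub>1 a' / 4) y\<close>. Hence \<open>N / m\<^sup>2\<close> times
  their Wronskian is constant, and it vanishes at \<open>0\<close>.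
\<close>

lemma hypF_transformation:
  fixes a b m q N a' b' m' q' :: "real \<Rightarrow> real" and c\<^sub>1 c\<^sub>2 :: real
  assumes range: "\<And>x. 0 \<le> x \<Longrightarrow> x < 1 \<Longrightarrow> 0 \<le> a x \<and> a x < 1 \<and> 0 \<le> b x \<and> b x < 1 \<and> 0 < m x"
    and N: "\<And>x. 0 < x \<Longrightarrow> x < 1 \<Longrightarrow> 0 < N x"
    and da: "\<And>x. 0 \<le> x \<Longrightarrow> x < 1 \<Longrightarrow> (a has_field_derivative a' x) (at x)"
    and db: "\<And>x. 0 \<le> x \<Longrightarrow> x < 1 \<Longrightarrow> (b has_field_derivative b' x) (at x)"
    and dm: "\<And>x. 0 \<le> x \<Longrightarrow> x < 1 \<Longrightarrow> (m has_field_derivative m' x) (at x)"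
    and dq: "\<And>x. 0 \<le> x \<Longrightarrow> x < 1 \<Longrightarrow> (q has_field_derivative q' x) (at x)"
    and a': "\<And>x. 0 < x \<Longrightarrow> x < 1 \<Longrightarrow> a' x = c\<^sub>1 * (m x)\<^sup>2 * a x * (1 - a x) / N x"
    and b': "\<And>x. 0 < x \<Longrightarrow> x < 1 \<Longrightarrow> b' x = c\<^sub>2 * b x * (1 - b x) / N x"
    and m': "\<And>x. 0 < x \<Longrightarrow> x < 1 \<Longrightarrow> m' x = q x * (m x)\<^sup>2 / N x"
    and q': "\<And>x. 0 < x \<Longrightarrow> x < 1 \<Longrightarrow> q' x = c\<^sub>1 * m x * a' x / 4 - c\<^sub>2 * b' x / (4 * m x)"
    and init: "a 0 = 0" "b 0 = 0" "m 0 = 1" "q 0 = 0"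
    and x: "0 \<le> x" "x < 1"
  shows "hypF (a x) = m x * hypF (b x)"
proof (cases "x = 0")
  case True
  then show ?thesis using init by (simp add: hypF_0)
next
  case False
  with x have x0: "0 < x" by simp
  define u where "u y = hypF (a y)" for y
  define v where "v y = m y * hypF (b y)" for y
  \<comment> \<open>On the open interval \<open>U\<close> and \<open>V\<close> are
    \<open>N / m\<^sup>2\<close> times the derivatives of \<open>u\<close> and \<open>v\<close>.
    Written without \<open>N\<close> in a denominator, they make sense at 0 as well, where
    \<open>N\<close> vanishes in both applications.\<close>
  define U where "U y = c\<^sub>1 * hypE (a y)" for y
  define V where "V y = q y * hypF (b y) + c\<^sub>2 * hypE (b y) / m y" for y
  have du: "(u has_field_derivative hypF' (a y) * a' y) (at y)" if "0 \<le> y" "y < 1" for y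
    unfolding u_def using range[OF that] that
    by (intro DERIV_chain2[OF has_field_derivative_hypF] da) auto
  have dFb: "((\<lambda>y. hypF (b y)) has_field_derivative hypF' (b y) * b' y) (at y)"
    if "0 \<le> y" "y < 1" for y
    using range[OF that] that
    by (intro DERIV_chain2[OF has_field_derivative_hypF] db) auto
  have dEb: "((\<lambda>y. hypE (b y)) has_field_derivative hypF (b y) / 4 * b' y) (at y)"
    if "0 \<le> y" "y < 1" for y
    using range[OF that] that
    by (intro DERIV_chain2[OF has_field_derivative_hypE] db) auto
  have dEa: "((\<lambda>y. hypE (a y)) has_field_derivative hypF (a y) / 4 * a' y) (at y)"
    if "0 \<le> y" "y < 1" for y
    using range[OF that] that
    by (intro DERIV_chain2[OF has_field_derivative_hypE] da) auto
  have dv: "(v has_field_derivative m' y * hypF (b y) + hypF' (b y) * b' y * m y) (at y)"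
    if "0 \<le> y" "y < 1" for y
    unfolding v_def using that by (intro DERIV_mult dm dFb)
  have dU: "(U has_field_derivative c\<^sub>1 * (hypF (a y) / 4 * a' y)) (at y)"
    if "0 \<le> y" "y < 1" for y
    unfolding U_def using that by (intro DERIV_cmult dEa)
  have dV: "(V has_field_derivative q' y * hypF (b y) + hypF' (b y) * b' y * q y +
      (c\<^sub>2 * (hypF (b y) / 4 * b' y) * m y - c\<^sub>2 * hypE (b y) * m' y) / (m y * m y)) (at y)"
    if "0 \<le> y" "y < 1" for y
    unfolding V_def using that range[OF that]
    by (intro DERIV_add DERIV_mult DERIV_divide DERIV_cmult dq dFb dm dEb) auto
  have u': "hypF' (a y) * a' y = (m y)\<^sup>2 * U y / N y" if "0 < y" "y < 1" for y
    using N[OF that] by (simp add: a'[OF that] U_def hypE_def)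
  have v': "m' y * hypF (b y) + hypF' (b y) * b' y * m y = (m y)\<^sup>2 * V y / N y"
    if "0 < y" "y < 1" for y
    using N[OF that] range[of y] that
    by (simp add: m'[OF that] b'[OF that] V_def hypE_def field_simps power2_eq_square)
  \<comment> \<open>The terms containing \<open>hypF' (b y)\<close> cancel, by the forms of
    \<open>b'\<close> and \<open>m'\<close>. The condition on \<open>q'\<close> turns the rest into
    the same multiple of \<open>v\<close> that the derivative of \<open>U\<close> is of
    \<open>u\<close>.\<close>
  have V': "q' y * hypF (b y) + hypF' (b y) * b' y * q y +
      (c\<^sub>2 * (hypF (b y) / 4 * b' y) * m y - c\<^sub>2 * hypE (b y) * m' y) / (m y * m y) =
      c\<^sub>1 * a' y / 4 * v y" if "0 < y" "y < 1" for y
  proof -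
    have "hypF' (b y) * b' y * q y = c\<^sub>2 * hypE (b y) * m' y / (m y * m y)"
      using N[OF that] range[of y] that
      by (simp add: m'[OF that] b'[OF that] hypE_def field_simps power2_eq_square)
    moreover have "q' y * hypF (b y) + c\<^sub>2 * (hypF (b y) / 4 * b' y) * m y / (m y * m y) =
        c\<^sub>1 * a' y / 4 * v y"
      using range[of y] that by (simp add: q'[OF that] v_def field_simps)
    ultimately show ?thesis
      by (simp add: diff_divide_distrib)
  qed
  define W where "W y = u y * V y - U y * v y" for y
  have dW: "(W has_field_derivative (hypF' (a y) * a' y) * V y + (q' y * hypF (b y) + hypF' (b y) * b' y * q y +
      (c\<^sub>2 * (hypF (b y) / 4 * b' y) * m y - c\<^sub>2 * hypE (b y) * m' y) / (m y * m y)) * u y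
      - (c\<^sub>1 * (hypF (a y) / 4 * a' y) * v y + (m' y * hypF (b y) + hypF' (b y) * b' y * m y) * U y)) (at y)"
    if "0 \<le> y" "y < 1" for y
    unfolding W_def using that by (intro DERIV_diff DERIV_mult du dV dU dv)
  have W0: "W y = 0" if "0 < y" "y < 1" for y
  proof -
    have "W y = W 0"
    proof (rule DERIV_isconst2[of 0 y W])
      show "continuous_on {0..y} W"
        using that by (intro continuous_at_imp_continuous_on) (auto intro: DERIV_isCont[OF dW])
      fix z assume z: "0 < z" "z < y"
      then have z1: "0 \<le> z" "z < 1" using that by auto
      show "(W has_field_derivative 0) (at z)"
        using dW[OF z1] unfolding u'[OF z(1) z1(2)] v'[OF z(1) z1(2)] V'[OF z(1) z1(2)]
        by (rule DERIV_cong) (simp add: u_def algebra_simps)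
    qed (use that in auto)
    also have "W 0 = 0"
      by (simp add: W_def U_def V_def init hypE_0)
    finally show ?thesis .
  qed
  have v_pos: "v y > 0" if "0 \<le> y" "y < 1" for y
    using range[OF that] unfolding v_def by (auto intro!: mult_pos_pos hypF_pos)
  have dr: "((\<lambda>y. u y / v y) has_field_derivative (hypF' (a y) * a' y * v y -
      u y * (m' y * hypF (b y) + hypF' (b y) * b' y * m y)) / (v y * v y)) (at y)"
    if "0 \<le> y" "y < 1" for y
    using v_pos[OF that] that by (intro DERIV_divide du dv) auto
  \<comment> \<open>A vanishing Wronskian makes the quotient of the two solutions constant, and the
    initial values fix the constant.\<close>
  have "u x / v x = u 0 / v 0"
  proof (rule DERIV_isconst2[of 0 x "\<lambda>y. u y / v y"])
    show "continuous_on {0..x} (\<lambda>y. u y / v y)"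
      using x by (intro continuous_at_imp_continuous_on) (auto intro: DERIV_isCont[OF dr])
    fix z assume z: "0 < z" "z < x"
    then have z1: "0 \<le> z" "z < 1" using x by auto
    show "((\<lambda>y. u y / v y) has_field_derivative 0) (at z)"
      using dr[OF z1] unfolding u'[OF z(1) z1(2)] v'[OF z(1) z1(2)]
    proof (rule DERIV_cong)
      have "(m z)\<^sup>2 * U z / N z * v z - u z * ((m z)\<^sup>2 * V z / N z) = - (m z)\<^sup>2 / N z * W z"
        by (simp add: W_def algebra_simps diff_divide_distrib)
      then show "((m z)\<^sup>2 * U z / N z * v z - u z * ((m z)\<^sup>2 * V z / N z)) / (v z * v z) = 0"
        using W0[OF z(1) z1(2)] by simp
    qed
  qed (use x0 in auto)
  also have "\<dots> = 1"
    by (simp add: u_def v_def init hypF_0)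
  finally show ?thesis
    using v_pos[OF x] by (simp add: u_def v_def)
qed

section \<open>The transformations of degree 2 and 3\<close>

lemma landen_transformation:
  assumes "0 \<le> x" "x < 1"
  shows "hypF (4 * x / (1 + x)\<^sup>2) = (1 + x) * hypF (x\<^sup>2)"
\<comment> \<open>The logarithmic derivative of \<open>b / (1 - b)\<close> for
  \<open>b = x\<^sup>2\<close> is \<open>2 / N\<close>, which determines \<open>N\<close>. The
  quotient of \<open>c\<^sub>2\<close> by \<open>c\<^sub>1\<close> is the degree of the
  transformation.\<close>
proof (rule hypF_transformation[where c\<^sub>1 = 1 and c\<^sub>2 = 2 and N = "\<lambda>x. x * (1 - x\<^sup>2)"
    and q = "\<lambda>x. x * (1 - x) / (1 + x)" and x = x
    and a' = "\<lambda>x. 4 * (1 - x) / (1 + x) ^ 3" and b' = "\<lambda>x. 2 * x" and m' = "\<lambda>x. 1"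
    and q' = "\<lambda>x. (1 - 2 * x - x\<^sup>2) / (1 + x)\<^sup>2"])
  have compl: "1 - 4 * y / (1 + y)\<^sup>2 = (1 - y)\<^sup>2 / (1 + y)\<^sup>2" if "0 \<le> y" for y :: real
    using that by (simp add: divide_simps) algebra
  fix y :: real
  assume y: "0 \<le> y" "y < 1"
  have "0 < 1 - 4 * y / (1 + y)\<^sup>2"
    unfolding compl[OF y(1)] using y by (intro divide_pos_pos) auto
  moreover have "y\<^sup>2 < 1"
    using y by (simp add: power_less_one_iff)
  ultimately show "0 \<le> 4 * y / (1 + y)\<^sup>2 \<and> 4 * y / (1 + y)\<^sup>2 < 1 \<and> 0 \<le> y\<^sup>2 \<and> y\<^sup>2 < 1 \<and> 0 < 1 + y"
    using y by auto
  show "((\<lambda>x. 4 * x / (1 + x)\<^sup>2) has_field_derivative 4 * (1 - y) / (1 + y) ^ 3) (at y)"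
    using y by (auto intro!: derivative_eq_intros simp: divide_simps) (auto simp: algebra_simps power_numeral_reduce)
  show "((\<lambda>x. x * (1 - x) / (1 + x)) has_field_derivative (1 - 2 * y - y\<^sup>2) / (1 + y)\<^sup>2) (at y)"
    using y by (auto intro!: derivative_eq_intros simp: divide_simps) (auto simp: algebra_simps power_numeral_reduce)
next
  fix y :: real
  assume y: "0 < y" "y < 1"
  have pos: "0 < 1 - y\<^sup>2"
    using y by (simp add: power_less_one_iff)
  then show "0 < y * (1 - y\<^sup>2)"
    using y by simp
  have fac: "1 - y\<^sup>2 = (1 - y) * (1 + y)"
    by (simp add: algebra_simps power2_eq_square)
  have compl: "1 - 4 * y / (1 + y)\<^sup>2 = (1 - y)\<^sup>2 / (1 + y)\<^sup>2"
    using y by (simp add: divide_simps) algebra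
  show "4 * (1 - y) / (1 + y) ^ 3 =
      1 * (1 + y)\<^sup>2 * (4 * y / (1 + y)\<^sup>2) * (1 - 4 * y / (1 + y)\<^sup>2) / (y * (1 - y\<^sup>2))"
    unfolding compl fac using y by (simp add: divide_simps) (simp add: algebra_simps power_numeral_reduce)
  show "2 * y = 2 * y\<^sup>2 * (1 - y\<^sup>2) / (y * (1 - y\<^sup>2))"
    using y pos by (simp add: power2_eq_square)
  show "1 = y * (1 - y) / (1 + y) * (1 + y)\<^sup>2 / (y * (1 - y\<^sup>2))"
    unfolding fac using y by (simp add: divide_simps power2_eq_square)
  show "(1 - 2 * y - y\<^sup>2) / (1 + y)\<^sup>2 =
      1 * (1 + y) * (4 * (1 - y) / (1 + y) ^ 3) / 4 - 2 * (2 * y) / (4 * (1 + y))"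
    using y by (simp add: divide_simps) (simp add: algebra_simps power_numeral_reduce)
qed (use assms in \<open>auto intro!: derivative_eq_intros\<close>)

text \<open>The factored complements show that both arguments stay below 1, and let \<open>N\<close>
  cancel in the differential conditions of \<open>cubic_transformation\<close>.\<close>

lemma cubic_complement:
  fixes p :: real
  assumes "0 \<le> p"
  shows "1 - p * (2 + p) ^ 3 / (1 + 2 * p) ^ 3 = (1 + p) * (1 - p) ^ 3 / (1 + 2 * p) ^ 3"
    and "1 - p ^ 3 * (2 + p) / (1 + 2 * p) = (1 + p) ^ 3 * (1 - p) / (1 + 2 * p)"
proof -
  have "(1 + 2 * p) ^ 3 \<noteq> 0" "1 + 2 * p \<noteq> 0"
    using assms by auto
  moreover have "(1 + 2 * p) ^ 3 - p * (2 + p) ^ 3 = (1 + p) * (1 - p) ^ 3"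
    "(1 + 2 * p) - p ^ 3 * (2 + p) = (1 + p) ^ 3 * (1 - p)"
    by algebra+
  ultimately show "1 - p * (2 + p) ^ 3 / (1 + 2 * p) ^ 3 = (1 + p) * (1 - p) ^ 3 / (1 + 2 * p) ^ 3"
    "1 - p ^ 3 * (2 + p) / (1 + 2 * p) = (1 + p) ^ 3 * (1 - p) / (1 + 2 * p)"
    by (simp_all add: diff_divide_eq_iff divide_diff_eq_iff)
qed

lemma cubic_range:
  fixes p :: real
  assumes "0 < p" "p < 1"
  shows "p * (2 + p) ^ 3 / (1 + 2 * p) ^ 3 \<in> {0<..<1}" "p ^ 3 * (2 + p) / (1 + 2 * p) \<in> {0<..<1}"
proof -
  have "0 < 1 - p * (2 + p) ^ 3 / (1 + 2 * p) ^ 3" "0 < 1 - p ^ 3 * (2 + p) / (1 + 2 * p)"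
    using assms by (simp_all add: cubic_complement)
  then show "p * (2 + p) ^ 3 / (1 + 2 * p) ^ 3 \<in> {0<..<1}" "p ^ 3 * (2 + p) / (1 + 2 * p) \<in> {0<..<1}"
    using assms by auto
qed

lemma cubic_transformation:
  assumes "0 \<le> p" "p < 1"
  shows "hypF (p * (2 + p) ^ 3 / (1 + 2 * p) ^ 3) =
    (1 + 2 * p) * hypF (p ^ 3 * (2 + p) / (1 + 2 * p))"
\<comment> \<open>Here the logarithmic derivatives of \<open>a / (1 - a)\<close> and
  \<open>b / (1 - b)\<close> are \<open>2 * m\<^sup>2 / N\<close> and \<open>6 / N\<close>, with
  multiplier \<open>m = 1 + 2 * p\<close>.\<close>
proof (rule hypF_transformation[where c\<^sub>1 = 2 and c\<^sub>2 = 6 and x = p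
    and N = "\<lambda>p. p * (1 + p) * (2 + p) * (1 - p)"
    and q = "\<lambda>p. 2 * (p * (1 + p) * (2 + p) * (1 - p)) / (1 + 2 * p)\<^sup>2"
    and a' = "\<lambda>p. 2 * (2 + p)\<^sup>2 * (1 - p)\<^sup>2 / (1 + 2 * p) ^ 4"
    and b' = "\<lambda>p. 6 * p\<^sup>2 * (1 + p)\<^sup>2 / (1 + 2 * p)\<^sup>2" and m' = "\<lambda>p. 2"
    and q' = "\<lambda>p. ((2 + p)\<^sup>2 * (1 - p)\<^sup>2 - 9 * p\<^sup>2 * (1 + p)\<^sup>2) / (1 + 2 * p) ^ 3"])
  fix y :: real
  assume y: "0 \<le> y" "y < 1"
  show "0 \<le> y * (2 + y) ^ 3 / (1 + 2 * y) ^ 3 \<and> y * (2 + y) ^ 3 / (1 + 2 * y) ^ 3 < 1 \<and>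
      0 \<le> y ^ 3 * (2 + y) / (1 + 2 * y) \<and> y ^ 3 * (2 + y) / (1 + 2 * y) < 1 \<and> 0 < 1 + 2 * y"
    using y cubic_range[of y] by (cases "y = 0") auto
  show "((\<lambda>p. p * (2 + p) ^ 3 / (1 + 2 * p) ^ 3) has_field_derivative
      2 * (2 + y)\<^sup>2 * (1 - y)\<^sup>2 / (1 + 2 * y) ^ 4) (at y)"
    using y by (auto intro!: derivative_eq_intros simp: divide_simps) algebra
  show "((\<lambda>p. p ^ 3 * (2 + p) / (1 + 2 * p)) has_field_derivative
      6 * y\<^sup>2 * (1 + y)\<^sup>2 / (1 + 2 * y)\<^sup>2) (at y)"
    using y by (auto intro!: derivative_eq_intros simp: divide_simps) algebra
  show "((\<lambda>p. 2 * (p * (1 + p) * (2 + p) * (1 - p)) / (1 + 2 * p)\<^sup>2) has_field_derivative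
      ((2 + y)\<^sup>2 * (1 - y)\<^sup>2 - 9 * y\<^sup>2 * (1 + y)\<^sup>2) / (1 + 2 * y) ^ 3) (at y)"
    using y by (auto intro!: derivative_eq_intros simp: divide_simps) algebra
next
  fix y :: real
  assume y: "0 < y" "y < 1"
  show "0 < y * (1 + y) * (2 + y) * (1 - y)"
    using y by simp
  have compl: "1 - y * (2 + y) ^ 3 / (1 + 2 * y) ^ 3 = (1 + y) * (1 - y) ^ 3 / (1 + 2 * y) ^ 3"
    "1 - y ^ 3 * (2 + y) / (1 + 2 * y) = (1 + y) ^ 3 * (1 - y) / (1 + 2 * y)"
    using cubic_complement y by auto
  show "2 * (2 + y)\<^sup>2 * (1 - y)\<^sup>2 / (1 + 2 * y) ^ 4 =
      2 * (1 + 2 * y)\<^sup>2 * (y * (2 + y) ^ 3 / (1 + 2 * y) ^ 3) *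
      (1 - y * (2 + y) ^ 3 / (1 + 2 * y) ^ 3) / (y * (1 + y) * (2 + y) * (1 - y))"
    unfolding compl using y by (simp add: divide_simps power_numeral_reduce)
  show "6 * y\<^sup>2 * (1 + y)\<^sup>2 / (1 + 2 * y)\<^sup>2 =
      6 * (y ^ 3 * (2 + y) / (1 + 2 * y)) * (1 - y ^ 3 * (2 + y) / (1 + 2 * y)) /
      (y * (1 + y) * (2 + y) * (1 - y))"
    unfolding compl using y by (simp add: divide_simps power_numeral_reduce)
  show "2 = 2 * (y * (1 + y) * (2 + y) * (1 - y)) / (1 + 2 * y)\<^sup>2 * (1 + 2 * y)\<^sup>2 /
      (y * (1 + y) * (2 + y) * (1 - y))"
    using y by simp
  show "((2 + y)\<^sup>2 * (1 - y)\<^sup>2 - 9 * y\<^sup>2 * (1 + y)\<^sup>2) / (1 + 2 * y) ^ 3 =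
      2 * (1 + 2 * y) * (2 * (2 + y)\<^sup>2 * (1 - y)\<^sup>2 / (1 + 2 * y) ^ 4) / 4 -
      6 * (6 * y\<^sup>2 * (1 + y)\<^sup>2 / (1 + 2 * y)\<^sup>2) / (4 * (1 + 2 * y))"
    using y by (simp add: divide_simps power_numeral_reduce) algebra
qed (use assms in \<open>auto intro!: derivative_eq_intros\<close>)

section \<open>Singular moduli\<close>

definition period_ratio :: "real \<Rightarrow> real" where
  "period_ratio z = hypF (1 - z) / hypF z"

lemma period_ratio_strict_antimono:
  assumes "0 < x" "x < y" "y < 1"
  shows "period_ratio y < period_ratio x"
  unfolding period_ratio_def
  using assms hypF_strict_mono[of x y] hypF_strict_mono[of "1 - y" "1 - x"]
    hypF_pos[of x] hypF_pos[of "1 - y"]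
  by (intro frac_less) auto

text \<open>Strict monotonicity of \<open>period_ratio\<close> supplies the uniqueness behind
  \<open>THE\<close>, so exhibiting one point with the right ratio is enough.\<close>

lemma singular_modulus_eqI:
  assumes "0 < \<alpha>" "\<alpha> < 1" "period_ratio \<alpha> = sqrt r"
  shows "singular_modulus r = \<alpha>"
  unfolding singular_modulus_def
proof (rule the_equality)
  show "0 < \<alpha> \<and> \<alpha> < 1 \<and> hyp2F1 (1/2) (1/2) 1 (1 - \<alpha>) / hyp2F1 (1/2) (1/2) 1 \<alpha> = sqrt r"
    using assms by (simp add: period_ratio_def hypF_def)
next
  fix \<beta>
  assume "0 < \<beta> \<and> \<beta> < 1 \<and> hyp2F1 (1/2) (1/2) 1 (1 - \<beta>) / hyp2F1 (1/2) (1/2) 1 \<beta> = sqrt r"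
  then have "0 < \<beta>" "\<beta> < 1" "period_ratio \<beta> = period_ratio \<alpha>"
    using assms(3) by (auto simp: period_ratio_def hypF_def)
  then show "\<beta> = \<alpha>"
    using assms(1,2) period_ratio_strict_antimono[of \<alpha> \<beta>] period_ratio_strict_antimono[of \<beta> \<alpha>]
    by (cases \<alpha> \<beta> rule: linorder_cases) auto
qed

section \<open>Effect of the transformations on the period ratio\<close>

lemma period_ratio_landen:
  assumes "0 < x" "x < 1"
  shows "period_ratio (x\<^sup>2) = 2 * period_ratio (4 * x / (1 + x)\<^sup>2)"
proof -
  \<comment> \<open>This involution exchanges each argument of Landen's formula with the complement
    of the other. The factor 2 is the product \<open>(1 + x) * (1 + y)\<close>.\<close>
  define y where "y = (1 - x) / (1 + x)"
  have y: "0 \<le> y" "y < 1"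
    using assms by (auto simp: y_def)
  have y1: "1 + y = 2 / (1 + x)"
    using assms by (simp add: y_def field_simps)
  have dual: "4 * y / (1 + y)\<^sup>2 = 1 - x\<^sup>2" "y\<^sup>2 = 1 - 4 * x / (1 + x)\<^sup>2"
    unfolding y1 using assms by (simp_all add: y_def divide_simps) algebra+
  have "hypF (1 - x\<^sup>2) = 2 / (1 + x) * hypF (1 - 4 * x / (1 + x)\<^sup>2)"
    using landen_transformation[OF y] unfolding dual unfolding y1 .
  moreover have "hypF (x\<^sup>2) = hypF (4 * x / (1 + x)\<^sup>2) / (1 + x)"
    using landen_transformation[of x] assms by simp
  ultimately show ?thesis
    using assms by (simp add: period_ratio_def)
qed

lemma period_ratio_cubic:
  assumes "0 < p" "p < 1"
  shows "period_ratio (p ^ 3 * (2 + p) / (1 + 2 * p)) =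
    3 * period_ratio (p * (2 + p) ^ 3 / (1 + 2 * p) ^ 3)"
proof -
  \<comment> \<open>The involution dual to the cubic parametrization;
    \<open>(1 + 2 * p) * (1 + 2 * s) = 3\<close> is the source of the factor 3.\<close>
  define s where "s = (1 - p) / (1 + 2 * p)"
  have s: "0 \<le> s" "s < 1"
    using assms by (auto simp: s_def)
  have lin: "1 + 2 * s = 3 / (1 + 2 * p)" "2 + s = 3 * (1 + p) / (1 + 2 * p)"
    using assms by (simp_all add: s_def field_simps)
  have dual: "s * (2 + s) ^ 3 / (1 + 2 * s) ^ 3 = 1 - p ^ 3 * (2 + p) / (1 + 2 * p)"
    "s ^ 3 * (2 + s) / (1 + 2 * s) = 1 - p * (2 + p) ^ 3 / (1 + 2 * p) ^ 3"
    unfolding lin using assms by (simp_all add: s_def divide_simps) algebra+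
  have "hypF (1 - p ^ 3 * (2 + p) / (1 + 2 * p)) =
      3 / (1 + 2 * p) * hypF (1 - p * (2 + p) ^ 3 / (1 + 2 * p) ^ 3)"
    using cubic_transformation[OF s] unfolding dual unfolding lin(1) .
  moreover have "hypF (p ^ 3 * (2 + p) / (1 + 2 * p)) =
      hypF (p * (2 + p) ^ 3 / (1 + 2 * p) ^ 3) / (1 + 2 * p)"
    using cubic_transformation[of p] assms by simp
  ultimately show ?thesis
    using assms by (simp add: period_ratio_def)
qed

text \<open>Here \<open>g\<close> is the fourth root of the product of the two moduli.\<close>

lemma period_ratio_cubic':
  assumes "0 < p" "p < 1" "p * (2 + p) = g * (1 + 2 * p)"
  shows "period_ratio (p\<^sup>2 * g) = 3 * period_ratio (g ^ 3 / p\<^sup>2)"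
    and "p\<^sup>2 * g \<in> {0<..<1}" "g ^ 3 / p\<^sup>2 \<in> {0<..<1}"
proof -
  have g: "g = p * (2 + p) / (1 + 2 * p)"
    using assms by (simp add: field_simps)
  have "p\<^sup>2 * g = p ^ 3 * (2 + p) / (1 + 2 * p)"
    by (simp add: g power_numeral_reduce)
  moreover have "g ^ 3 / p\<^sup>2 = p * (2 + p) ^ 3 / (1 + 2 * p) ^ 3"
    using assms(1) by (simp add: g power_numeral_reduce)
  ultimately show "period_ratio (p\<^sup>2 * g) = 3 * period_ratio (g ^ 3 / p\<^sup>2)"
    "p\<^sup>2 * g \<in> {0<..<1}" "g ^ 3 / p\<^sup>2 \<in> {0<..<1}"
    using period_ratio_cubic[OF assms(1,2)] cubic_range[OF assms(1,2)] by simp_all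
qed

lemma period_ratio_4: "period_ratio ((sqrt 2 - 1) ^ 4) = 2"
proof -
  \<comment> \<open>The root in \<open>(0, 1)\<close> of \<open>8 * x = (1 + x)\<^sup>2\<close>, for
    which the Landen argument is the self-complementary point \<open>1/2\<close>.\<close>
  define x :: real where "x = (sqrt 2 - 1)\<^sup>2"
  have s: "sqrt 2 ^ 2 = 2" "1 < sqrt 2" "sqrt 2 < 2"
    using real_sqrt_less_iff[of 2 4] by auto
  have x: "0 < x" "x < 1"
    using s by (auto simp: x_def power_less_one_iff)
  have x_eq: "x = 3 - 2 * sqrt 2"
    by (simp add: x_def power2_diff)
  have "8 * x = (1 + x)\<^sup>2"
    unfolding x_eq using s(1) by (simp add: power2_eq_square algebra_simps)
  then have "4 * x / (1 + x)\<^sup>2 = 1/2"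
    using x by (simp add: divide_simps)
  moreover have "period_ratio (1/2) = 1"
    using hypF_pos[of "1/2"] by (simp add: period_ratio_def)
  ultimately show ?thesis
    using period_ratio_landen[OF x] by (simp add: x_def flip: power_mult)
qed

section \<open>Evaluation in the field generated by the square root of 2 and the fourth root of
  3\<close>

theorem theorem5p1:
  shows "singular_modulus 36 =
            (sqrt 2 - 1) ^ 4 * (sqrt 3 - sqrt 2) ^ 4 *
            (sqrt ((sqrt 3 + 3) / 2) - sqrt ((sqrt 3 + 1) / 2)) ^ 8 \<and>
         singular_modulus (4/9) =
            (sqrt 2 - 1) ^ 4 * (sqrt 3 - sqrt 2) ^ 4 *
            (sqrt ((sqrt 3 + 3) / 2) + sqrt ((sqrt 3 + 1) / 2)) ^ 8"
proof -
  define s t A B where "s = sqrt 2" and "t = sqrt (sqrt 3)"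
    and "A = sqrt ((sqrt 3 + 3) / 2)" and "B = sqrt ((sqrt 3 + 1) / 2)"
  have s2: "s\<^sup>2 = 2" and t2: "t\<^sup>2 = sqrt 3"
    by (simp_all add: s_def t_def)
  have t4: "t ^ 4 = 3"
    using arg_cong[OF t2, of "\<lambda>x. x\<^sup>2"] by (simp flip: power_mult)
  \<comment> \<open>Rewrite rules reducing polynomials in \<open>s\<close> and \<open>t\<close>
    modulo \<open>s\<^sup>2 = 2\<close> and \<open>t ^ 4 = 3\<close>; the variants with
    \<open>x\<close> act inside right-nested products.\<close>
  have red: "s * s = 2" "s * (s * x) = 2 * x"
    "t * (t * (t * t)) = 3" "t * (t * (t * (t * x))) = 3 * x" for x
    using s2 t4 by (simp_all add: power2_eq_square power4_eq_xxxx mult.assoc[symmetric])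
  note ring_red = power_numeral_reduce algebra_simps divide_simps red
  have nonneg: "0 \<le> s" "0 \<le> t"
    by (simp_all add: s_def t_def)
  have "1\<^sup>2 < s\<^sup>2" "s\<^sup>2 < 2\<^sup>2" "1 ^ 4 < t ^ 4" "t ^ 4 < (4/3) ^ 4"
    unfolding s2 t4 by (simp_all add: power_divide)
  then have s_bounds: "1 < s" "s < 2" and t_bounds: "1 < t" "t < 4/3"
    using nonneg by - (erule power_less_imp_less_base, simp)+

  \<comment> \<open>Since \<open>A\<^sup>2 - B\<^sup>2 = 1\<close>, these are mutually inverse; the
    eighth powers in the claim are \<open>u ^ 4\<close> and \<open>v ^ 4\<close>.\<close>
  define u v where "u = (A - B)\<^sup>2" and "v = (A + B)\<^sup>2"
  have AB: "A\<^sup>2 = (t\<^sup>2 + 3) / 2" "B\<^sup>2 = (t\<^sup>2 + 1) / 2" "2 * (A * B) = t + t ^ 3"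
  proof -
    show sq: "A\<^sup>2 = (t\<^sup>2 + 3) / 2" "B\<^sup>2 = (t\<^sup>2 + 1) / 2"
      by (simp_all add: A_def B_def t2)
    have "(2 * (A * B))\<^sup>2 = 4 * (A\<^sup>2 * B\<^sup>2)"
      by (simp add: power_mult_distrib)
    also have "\<dots> = (t + t ^ 3)\<^sup>2"
      unfolding sq by (simp add: ring_red)
    finally have "(2 * (A * B))\<^sup>2 = (t + t ^ 3)\<^sup>2" .
    then show "2 * (A * B) = t + t ^ 3"
      by (rule power2_eq_imp_eq) (simp_all add: A_def B_def t_def)
  qed
  have u: "u = 2 + t\<^sup>2 - t - t ^ 3" and v: "v = 2 + t\<^sup>2 + t + t ^ 3"
    using AB by (simp_all add: u_def v_def power2_diff power2_sum field_simps)
  have uv: "u * v = 1"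
    unfolding u v by (simp add: ring_red)
  have v_gt: "v > 1"
    using t_bounds by (simp add: v add_pos_pos)
  have u_bounds: "0 < u" "u < 1"
  proof -
    have "u = 1 / v"
      using uv v_gt by (simp add: field_simps)
    then show "0 < u" "u < 1"
      using v_gt by auto
  qed
  define d e where "d = t\<^sup>2 - s" and "e = t\<^sup>2 + s"
  have de: "d * e = 1"
    unfolding d_def e_def by (simp add: ring_red)
  have e_gt: "e > 1"
    using s_bounds zero_le_power2[of t] unfolding e_def by linarith
  have d_bounds: "0 < d" "d < 1"
  proof -
    have "d = 1 / e"
      using de e_gt by (simp add: field_simps)
    then show "0 < d" "d < 1"
      using e_gt by auto
  qed

  text \<open>Roots in \<open>\<rat>(s, t)\<close> of the quartics saying that the cubic pair with parameter \<open>p\<close> has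
    its smaller, respectively larger, member equal to \<open>(s - 1)\<^sup>4\<close>.\<close>
  define p where "p = (t - 1) * (1 - t\<^sup>2 + s * t\<^sup>2) / 2"
  define p' where "p' = p * d\<^sup>2 * u"
  have p_sq: "p\<^sup>2 = (s - 1)\<^sup>2 * e * u"
    unfolding p_def e_def u by (simp add: ring_red)
  \<comment> \<open>The factor \<open>(s - 1)\<^sup>2 * d * v\<close> is the \<open>g\<close> of
    \<open>period_ratio_cubic'\<close>: its fourth power is \<open>(s - 1) ^ 4\<close> times the
    claimed second modulus.\<close>
  have p_eq: "p * (2 + p) = (s - 1)\<^sup>2 * d * v * (1 + 2 * p)"
    unfolding p_def d_def v by (simp add: ring_red)
  \<comment> \<open>Expanding \<open>p'\<close> in the monomials of the field over the rationals
    keeps the degree low when \<open>p'_eq\<close> is checked.\<close>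
  have p'_lin: "p' = (65 - 51 * t + 39 * t\<^sup>2 - 29 * t ^ 3
      - 48 * s + 36 * (s * t) - 27 * (s * t\<^sup>2) + 21 * (s * t ^ 3)) / 2"
    unfolding p'_def p_def d_def u by (simp add: ring_red)
  have p'_sq: "p'\<^sup>2 = (s - 1)\<^sup>2 * d ^ 3 * u ^ 3"
  proof -
    have "p'\<^sup>2 = (s - 1)\<^sup>2 * d ^ 3 * u ^ 3 * (d * e)"
      unfolding p'_def power_mult_distrib p_sq by algebra
    then show ?thesis
      by (simp add: de)
  qed
  have p'_eq: "p' * (2 + p') = (s - 1)\<^sup>2 * d * u * (1 + 2 * p')"
    unfolding p'_lin d_def u by (simp add: ring_red)

  have p_bounds: "0 < p" "p < 1"
  proof -
    have p: "p = (t - 1) * (1 + (s - 1) * t\<^sup>2) / 2"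
      by (simp add: p_def algebra_simps)
    have "0 < 1 + (s - 1) * t\<^sup>2"
      using s_bounds t_bounds by (intro add_pos_pos mult_pos_pos) auto
    then show "0 < p"
      unfolding p using t_bounds by simp
    \<comment> \<open>Crude bounds suffice: \<open>t < 4/3\<close> and
      \<open>1 + (s - 1) * t\<^sup>2 \<le> 5\<close> give \<open>p \<le> 5/6\<close>.\<close>
    have "t\<^sup>2 < 2\<^sup>2"
      using t_bounds by (intro power_strict_mono) auto
    then have "(s - 1) * t\<^sup>2 \<le> 1 * 4"
      using s_bounds by (intro mult_mono) auto
    then have "(t - 1) * (1 + (s - 1) * t\<^sup>2) \<le> 1/3 * 5"
      using t_bounds \<open>0 < 1 + (s - 1) * t\<^sup>2\<close> by (intro mult_mono) auto
    then show "p < 1"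
      unfolding p by simp
  qed
  have p'_bounds: "0 < p'" "p' < 1"
  proof -
    show "0 < p'"
      unfolding p'_def using p_bounds d_bounds u_bounds by simp
    have "p * d\<^sup>2 * u < 1 * 1 * 1"
      using p_bounds d_bounds u_bounds
      by (intro mult_strict_mono) (auto simp: power_less_one_iff)
    then show "p' < 1"
      by (simp add: p'_def)
  qed

  let ?g = "(s - 1)\<^sup>2 * d * v" and ?g' = "(s - 1)\<^sup>2 * d * u"
  have nz: "s - 1 \<noteq> 0" "d \<noteq> 0" "e \<noteq> 0" "u \<noteq> 0"
    using s_bounds d_bounds e_gt u_bounds by auto
  have "p'\<^sup>2 * ?g' = (s - 1) ^ 4 * d ^ 4 * u ^ 4"
    unfolding p'_sq by algebra
  moreover have "?g' ^ 3 / p'\<^sup>2 = (s - 1) ^ 4"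
    unfolding p'_sq using nz
    by (simp add: power_mult_distrib flip: power_mult) (simp add: divide_simps flip: power_add)
  \<comment> \<open>The larger member of the pair is \<open>(s - 1) ^ 4\<close>, of ratio 2, so the
    smaller has ratio 6, the square root of 36.\<close>
  ultimately have "singular_modulus 36 = (s - 1) ^ 4 * d ^ 4 * u ^ 4"
    using period_ratio_cubic'[OF p'_bounds p'_eq] period_ratio_4
    by (intro singular_modulus_eqI) (auto simp: s_def intro!: real_sqrt_unique[symmetric])
  moreover have "p\<^sup>2 * ?g = (s - 1) ^ 4"
  proof -
    have "p\<^sup>2 * ?g = (s - 1) ^ 4 * (d * e) * (u * v)"
      unfolding p_sq by algebra
    then show ?thesis
      by (simp add: de uv)
  qed
  moreover have "?g ^ 3 / p\<^sup>2 = (s - 1) ^ 4 * d ^ 4 * v ^ 4"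
  proof -
    have "(s - 1) ^ 4 * d ^ 4 * v ^ 4 * p\<^sup>2 = ?g ^ 3 * (d * e) * (u * v)"
      unfolding p_sq by algebra
    then show ?thesis
      using p_bounds by (simp add: de uv divide_eq_eq)
  qed
  \<comment> \<open>Now \<open>(s - 1) ^ 4\<close> is the smaller member, so the larger has ratio
    \<open>2/3\<close>, the square root of \<open>4/9\<close>.\<close>
  ultimately have "singular_modulus (4/9) = (s - 1) ^ 4 * d ^ 4 * v ^ 4"
    using period_ratio_cubic'[OF p_bounds p_eq] period_ratio_4
    by (intro singular_modulus_eqI) (auto simp: s_def real_sqrt_divide)
  with \<open>singular_modulus 36 = _\<close> show ?thesis
    by (simp add: u_def v_def d_def t2 s_def A_def B_def flip: power_mult)
qed

end
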